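(* Let $n>5$. For every $\kappa=(\kappa_1,\dots,\kappa_{n-1})\in\mathbb{R}^{n-1}$ with $\kappa_i\ge 1$ for all $i$, one has, with $\sigma_k=\sigma_k(\kappa)$, $$\left(5\frac{\sigma_5\sigma_3}{\sigma_4}-\frac{4(n-5)}{n-4}\sigma_4\right)+\frac{(n-4)(n-5)}{6}\left(\frac{4(n-3)}{n-4}\sigma_2-3\frac{\sigma_3^2}{\sigma_4}\right)+\frac{(n-2)(n-3)(n-4)(n-5)}{24}\left(\frac{\sigma_1\sigma_3}{\sigma_4}-\frac{4(n-1)}{n-4}\right)\le 0.$$ Equality holds if and only if one of the following two cases holds: (i) $\kappa_i=\kappa_j$ for all $i,j$; or (ii) there exists $i$ with $\kappa_i>1$ and $\kappa_j=1$ for all $j\ne i$.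
   Context: $\sigma_k(\kappa)=\sum_{1\le i_1<\dots<i_k\le n-1}\kappa_{i_1}\cdots\kappa_{i_k}$ denotes the $k$-th elementary symmetric function of the $n-1$ variables $\kappa_1,\dots,\kappa_{n-1}$. *)

theory Defs
  imports Complex_Main
begin

(* The k-th elementary symmetric function of the variables x i, i \<in> A. For a finite index set A
   of naturals, increasing index tuples i_1 < ... < i_k in A correspond to k-element subsets of A. *)
definition esym :: "'i set \<Rightarrow> nat \<Rightarrow> ('i \<Rightarrow> real) \<Rightarrow> real" where
  "esym A k x = (\<Sum>S | S \<subseteq> A \<and> card S = k. \<Prod>i\<in>S. x i)"

end

theory Submission
  imports Defs
begin

text \<open>
  Put \<open>\<kappa> i = 1 + x i\<close> with \<open>x i \<ge> 0\<close>, let \<open>m = n - 1\<close>, and let \<open>p k\<close> and \<open>q k\<close> be the elementary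
  symmetric means (\<open>\<sigma> k\<close> divided by \<open>m choose k\<close>) of \<open>\<kappa>\<close> and of \<open>x\<close>. The left-hand side is a positive
  multiple of \<open>p 3 * (p 5 - 2 * p 3 + p 1) - p 4 * (p 4 - 2 * p 2 + 1)\<close>. As \<open>p k\<close> is the sum of
  \<open>(k choose j) * q j\<close> over \<open>j \<le> k\<close>, expanding this in \<open>q\<close> gives, degree by degree, minus a
  nonnegative combination of Newton differences \<open>q (i+1) * q j - q i * q (j+1)\<close> with \<open>i \<le> j\<close>.
  The lowest-degree part is \<open>4 * (q 1 * q 2 - q 3)\<close>; it vanishes only if \<open>q 2 = 0\<close> (at most one \<open>x i\<close> is
  nonzero) or \<open>q 1 ^ 2 = q 2\<close> (all \<open>x i\<close> are equal).
\<close>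

section \<open>Elementary symmetric sums and their means\<close>

text \<open>For finite \<open>A\<close> and \<open>k > card A\<close> numerator and denominator are
  both 0, and division by zero makes the mean 0, so identities such as \<open>esym_eq_mean\<close>
  hold for every \<open>k\<close>.\<close>

definition esym_mean :: "'i set \<Rightarrow> nat \<Rightarrow> ('i \<Rightarrow> real) \<Rightarrow> real" where
  "esym_mean A k x = esym A k x / real (card A choose k)"

lemma esym_0 [simp]: "finite A \<Longrightarrow> esym A 0 x = 1"
proof -
  assume "finite A"
  then have "{S. S \<subseteq> A \<and> card S = 0} = {{}}"
    by (auto dest: finite_subset)
  then show ?thesis
    by (simp add: esym_def)
qed

lemma esym_eq_0_if_card_less: "finite A \<Longrightarrow> card A < k \<Longrightarrow> esym A k x = 0"
proof -
  assume "finite A" "card A < k"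
  then have "{S. S \<subseteq> A \<and> card S = k} = {}"
    by (auto dest: card_mono)
  then show ?thesis
    by (simp only: esym_def sum.empty)
qed

lemma esym_nonneg: "(\<And>i. i \<in> A \<Longrightarrow> 0 \<le> x i) \<Longrightarrow> 0 \<le> esym A k x"
  unfolding esym_def by (intro sum_nonneg prod_nonneg) auto

text \<open>The subsets of \<open>insert a A\<close> of size \<open>Suc k\<close> are split by
  whether they contain \<open>a\<close>.\<close>

lemma esym_insert:
  assumes "finite A" "a \<notin> A"
  shows "esym (insert a A) (Suc k) x = esym A (Suc k) x + x a * esym A k x"
proof -
  let ?U = "{S. S \<subseteq> A \<and> card S = Suc k}" and ?V = "{S. S \<subseteq> A \<and> card S = k}"
  have fin: "finite S" if "S \<subseteq> A" for S
    using that assms(1) finite_subset by blast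
  have "{S. S \<subseteq> insert a A \<and> card S = Suc k} = ?U \<union> insert a ` ?V"
  proof (intro subset_antisym subsetI)
    fix S assume S: "S \<in> {S. S \<subseteq> insert a A \<and> card S = Suc k}"
    show "S \<in> ?U \<union> insert a ` ?V"
    proof (cases "a \<in> S")
      case True
      then have "S = insert a (S - {a})" "S - {a} \<in> ?V"
        using S by auto
      then show ?thesis by blast
    qed (use S in auto)
  next
    fix S assume "S \<in> ?U \<union> insert a ` ?V"
    then show "S \<in> {S. S \<subseteq> insert a A \<and> card S = Suc k}"
      using assms(2) fin by (auto simp: card_insert_if)
  qed
  moreover have "?U \<inter> insert a ` ?V = {}"
    using assms(2) by auto
  moreover have "inj_on (insert a) ?V"
    using assms(2) by (auto simp: inj_on_def insert_ident subset_iff)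
  moreover have "(\<Prod>i\<in>insert a S. x i) = x a * (\<Prod>i\<in>S. x i)" if "S \<in> ?V" for S
    using that assms(2) fin by (subst prod.insert) auto
  ultimately show ?thesis
    using assms(1) unfolding esym_def
    by (simp add: sum.union_disjoint sum.reindex sum_distrib_left)
qed

text \<open>Excludes internal zeros, as \<open>log_concave_mult_le\<close> requires. Both summands
  of \<open>esym_insert\<close> are nonnegative, so a vanishing sum makes each of them
  vanish.\<close>

lemma esym_Suc_eq_0:
  assumes "finite A" "\<And>i. i \<in> A \<Longrightarrow> 0 \<le> x i" "esym A k x = 0"
  shows "esym A (Suc k) x = 0"
  using assms
proof (induction A arbitrary: k rule: finite_induct)
  case empty
  then show ?case by (simp add: esym_eq_0_if_card_less)
next
  case (insert a A)
  then obtain l where l: "k = Suc l"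
    by (cases k) auto
  have "0 \<le> esym A (Suc l) x" "0 \<le> x a * esym A l x"
    using insert.prems(1) by (auto intro!: esym_nonneg mult_nonneg_nonneg)
  moreover have "esym A (Suc l) x + x a * esym A l x = 0"
    using insert.prems(2) insert.hyps by (simp add: l esym_insert)
  ultimately have "esym A (Suc l) x = 0"
    by linarith
  moreover from this have "esym A (Suc (Suc l)) x = 0"
    using insert by blast
  ultimately show ?case
    using insert.hyps by (simp add: l esym_insert)
qed

lemma esym_mean_0 [simp]: "finite A \<Longrightarrow> esym_mean A 0 x = 1"
  by (simp add: esym_mean_def)

lemma esym_mean_nonneg: "(\<And>i. i \<in> A \<Longrightarrow> 0 \<le> x i) \<Longrightarrow> 0 \<le> esym_mean A k x"
  unfolding esym_mean_def by (intro divide_nonneg_nonneg esym_nonneg) auto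

lemma esym_mean_eq_0_iff: "finite A \<Longrightarrow> esym_mean A k x = 0 \<longleftrightarrow> esym A k x = 0"
  by (cases "card A < k") (auto simp: esym_mean_def esym_eq_0_if_card_less)

lemma esym_eq_mean: "finite A \<Longrightarrow> esym A k x = real (card A choose k) * esym_mean A k x"
  by (cases "card A < k") (auto simp: esym_mean_def esym_eq_0_if_card_less)

text \<open>This is \<open>esym_insert\<close> after normalisation; the weights come from the
  absorption identities for binomial coefficients. It drives all later inductions on
  \<open>A\<close>.\<close>

lemma esym_mean_insert:
  assumes "finite A" "a \<notin> A"
  shows "real (card A + 1) * esym_mean (insert a A) (Suc k) x =
    (real (card A) - real k) * esym_mean A (Suc k) x + real (Suc k) * x a * esym_mean A k x"
proof (cases "card A < k")
  case True
  then show ?thesis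
    using assms by (simp add: esym_mean_def esym_eq_0_if_card_less)
next
  case False
  let ?c = "card A"
  have C: "0 < ?c choose k" "0 < Suc ?c choose Suc k"
    using False by auto
  have k: "real (Suc k) * real (Suc ?c choose Suc k) = real (Suc ?c) * real (?c choose k)"
    by (metis Suc_times_binomial_eq mult.commute of_nat_mult)
  have 1: "real (Suc ?c) * (esym A k x / real (Suc ?c choose Suc k)) = real (Suc k) * esym_mean A k x"
    using C k by (simp add: esym_mean_def field_simps del: binomial_Suc_Suc of_nat_Suc)
  have 2: "real (Suc ?c) * (esym A (Suc k) x / real (Suc ?c choose Suc k)) =
      (real ?c - real k) * esym_mean A (Suc k) x"
  \<comment> \<open>For \<open>?c = k\<close> there is no subset of size \<open>Suc k\<close>, and
    the weight on the right is 0 as well. Otherwise all binomials involved are positive and may be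
    cancelled.\<close>
  proof (cases "?c = k")
    case True
    then show ?thesis
      using assms by (simp add: esym_mean_def esym_eq_0_if_card_less)
  next
    case ne: False
    then have "0 < ?c choose Suc k"
      using False by auto
    moreover have "(?c - k) * (?c choose k) = Suc k * (?c choose Suc k)"
      by (simp only: binomial_absorb_comp binomial_absorption)
    then have "(real ?c - real k) * real (?c choose k) = real (Suc k) * real (?c choose Suc k)"
      using False by (metis not_less of_nat_diff of_nat_mult)
    then have "real (Suc k) * ((real ?c - real k) * real (Suc ?c choose Suc k)) =
        real (Suc k) * (real (Suc ?c) * real (?c choose Suc k))"
      using k by algebra
    then have "(real ?c - real k) * real (Suc ?c choose Suc k) =
        real (Suc ?c) * real (?c choose Suc k)"
      by (simp del: binomial_Suc_Suc of_nat_Suc)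
    ultimately have "real (Suc ?c) / real (Suc ?c choose Suc k) = (real ?c - real k) / real (?c choose Suc k)"
      using C by (simp add: frac_eq_eq del: binomial_Suc_Suc of_nat_Suc)
    then have "real (Suc ?c) / real (Suc ?c choose Suc k) * esym A (Suc k) x =
        (real ?c - real k) / real (?c choose Suc k) * esym A (Suc k) x"
      by (rule arg_cong)
    then show ?thesis
      by (simp add: esym_mean_def del: binomial_Suc_Suc of_nat_Suc)
  qed
  have "real (card A + 1) * esym_mean (insert a A) (Suc k) x =
      real (Suc ?c) * (esym A (Suc k) x / real (Suc ?c choose Suc k)) +
      x a * (real (Suc ?c) * (esym A k x / real (Suc ?c choose Suc k)))"
    using assms by (simp add: esym_mean_def esym_insert add_divide_distrib distrib_left
        del: binomial_Suc_Suc of_nat_Suc)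
  then show ?thesis
    unfolding 1 2 by (simp add: algebra_simps)
qed

section \<open>Log-concave sequences and Newton's inequalities\<close>

text \<open>The ratios \<open>q (Suc k) / q k\<close> of a log-concave sequence decrease. The
  induction on \<open>j\<close> avoids quotients by multiplying with \<open>q j\<close>; if
  \<open>q j = 0\<close>, the left-hand side of the new inequality is 0.\<close>

lemma log_concave_mult_le:
  fixes q :: "nat \<Rightarrow> real"
  assumes nonneg: "\<And>k. 0 \<le> q k"
    and zero: "\<And>k. q k = 0 \<Longrightarrow> q (Suc k) = 0"
    and conc: "\<And>k. q k * q (Suc (Suc k)) \<le> (q (Suc k))\<^sup>2"
    and "i \<le> j"
  shows "q i * q (Suc j) \<le> q (Suc i) * q j"
  using \<open>i \<le> j\<close>
proof (induction j rule: dec_induct)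
  case base
  then show ?case by simp
next
  case (step j)
  show ?case
  proof (cases "q j = 0")
    case True
    then show ?thesis by (simp add: zero)
  next
    case False
    then have pos: "0 < q j"
      using nonneg [of j] by linarith
    have "q j * (q i * q (Suc (Suc j))) = q i * (q j * q (Suc (Suc j)))"
      by simp
    also have "\<dots> \<le> q i * (q (Suc j))\<^sup>2"
      by (intro mult_left_mono conc nonneg)
    also have "\<dots> = (q i * q (Suc j)) * q (Suc j)"
      by (simp add: power2_eq_square)
    also have "\<dots> \<le> (q (Suc i) * q j) * q (Suc j)"
      by (intro mult_right_mono step.IH nonneg)
    also have "\<dots> = q j * (q (Suc i) * q (Suc j))"
      by simp
    finally show ?thesis
      using pos by simp
  qed
qed

text \<open>Middle order 1, where no mean two orders below exists, is treated apart from
  \<open>newton_step\<close>. The square is kept in the bound because it later decides the equality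
  case.\<close>

lemma newton_step_0:
  fixes m x q1 q2 r1 r2 :: real
  assumes "2 \<le> m" and q: "q2 \<le> q1\<^sup>2"
    and r1: "m * r1 = (m - 1) * q1 + x"
    and r2: "m * r2 = (m - 2) * q2 + 2 * x * q1"
  shows "(q1 - x)\<^sup>2 \<le> m\<^sup>2 * (r1\<^sup>2 - r2)"
proof -
  have "m\<^sup>2 * (r1\<^sup>2 - r2) = (m * r1)\<^sup>2 - m * (m * r2)"
    by (simp add: power2_eq_square algebra_simps)
  also have "\<dots> = (q1 - x)\<^sup>2 + m * (m - 2) * (q1\<^sup>2 - q2)"
    unfolding r1 r2 by (simp add: power2_eq_square algebra_simps)
  finally show ?thesis
    using assms(1) q by simp
qed

text \<open>Here \<open>a\<close>, \<open>b\<close>, \<open>c\<close>, \<open>d\<close> play the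
  means of orders \<open>k - 2\<close> to \<open>k + 1\<close> of the old variables,
  \<open>x\<close> is the new variable, \<open>m\<close> the new number of variables, and
  \<open>r1\<close>, \<open>r2\<close>, \<open>r3\<close> are the new means of orders
  \<open>k - 1\<close> to \<open>k + 1\<close>.\<close>

lemma newton_step:
  fixes m k x :: real
  assumes "2 \<le> k" "k \<le> m - 1" "0 \<le> x"
    and "a * c \<le> b\<^sup>2" "b * d \<le> c\<^sup>2" "a * d \<le> b * c"
    and r1: "m * r1 = (m - (k - 1)) * b + (k - 1) * x * a"
    and r2: "m * r2 = (m - k) * c + k * x * b"
    and r3: "m * r3 = (m - (k + 1)) * d + (k + 1) * x * c"
  shows "r1 * r3 \<le> r2\<^sup>2"
proof -
  have "m\<^sup>2 * (r2\<^sup>2 - r1 * r3) = (m * r2)\<^sup>2 - (m * r1) * (m * r3)"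
    by (simp add: power2_eq_square algebra_simps)
  \<comment> \<open>Writing \<open>(m - k)^2\<close> as \<open>1 + (m - k - 1) * (m - k + 1)\<close>
    and \<open>k^2\<close> as \<open>1 + (k - 1) * (k + 1)\<close> splits off a square; what remains
    of the cross term is a multiple of \<open>b * c - a * d\<close>.\<close>
  also have "\<dots> = (c - x * b)\<^sup>2 + (m - k - 1) * (m - k + 1) * (c\<^sup>2 - b * d)
      + (k - 1) * (m - k - 1) * x * (b * c - a * d) + (k - 1) * (k + 1) * x\<^sup>2 * (b\<^sup>2 - a * c)"
    unfolding r1 r2 r3 by (simp add: power2_eq_square algebra_simps)
  also have "\<dots> \<ge> 0"
    using assms by (intro add_nonneg_nonneg mult_nonneg_nonneg) auto
  finally have "0 \<le> m\<^sup>2 * (r2\<^sup>2 - r1 * r3)" .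
  moreover have "0 < m\<^sup>2"
    using assms by simp
  ultimately show ?thesis
    by (simp add: zero_le_mult_iff)
qed

text \<open>
  Newton's inequalities, by adding one variable at a time. Nonnegativity of the variables is what
  allows the cross term, which needs the two-step inequality from \<open>log_concave_mult_le\<close>, to be
  absorbed (see \<open>newton_step\<close>).
\<close>

theorem esym_mean_newton:
  assumes "finite A" "\<And>i. i \<in> A \<Longrightarrow> 0 \<le> x i"
  shows "esym_mean A k x * esym_mean A (Suc (Suc k)) x \<le> (esym_mean A (Suc k) x)\<^sup>2"
  using assms
proof (induction A arbitrary: k rule: finite_induct)
  case empty
  then show ?case by (simp add: esym_mean_def esym_eq_0_if_card_less)
next
  case (insert a A)
  let ?q = "\<lambda>k. esym_mean A k x" and ?r = "\<lambda>k. esym_mean (insert a A) k x"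
  let ?m = "real (card A + 1)"
  have nonneg: "0 \<le> ?q k" for k
    using insert.prems by (intro esym_mean_nonneg) auto
  have conc: "?q k * ?q (Suc (Suc k)) \<le> (?q (Suc k))\<^sup>2" for k
    using insert by simp
  have r: "?m * ?r (Suc k) = (?m - real (Suc k)) * ?q (Suc k) + real (Suc k) * x a * ?q k" for k
    using esym_mean_insert [OF insert.hyps] by simp
  show ?case
  proof (cases "card A \<le> k")
    \<comment> \<open>Now \<open>Suc (Suc k)\<close> exceeds the size of \<open>insert a A\<close>,
      so the left-hand side is 0.\<close>
    case True
    then show ?thesis
      using insert.hyps by (simp add: esym_mean_def esym_eq_0_if_card_less)
  next
    case le: False
    show ?thesis
    proof (cases k)
      case 0
      have "(?q 1 - x a)\<^sup>2 \<le> ?m\<^sup>2 * ((?r 1)\<^sup>2 - ?r 2)"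
      proof (rule newton_step_0)
        show "?q 2 \<le> (?q 1)\<^sup>2"
          using conc [of 0] insert.hyps by (simp add: numeral_2_eq_2)
        show "?m * ?r 1 = (?m - 1) * ?q 1 + x a"
          using r [of 0] insert.hyps by simp
        show "?m * ?r 2 = (?m - 2) * ?q 2 + 2 * x a * ?q 1"
          using r [of 1] by (simp add: numeral_2_eq_2)
      qed (use le 0 in simp)
      then have "0 \<le> ?m\<^sup>2 * ((?r 1)\<^sup>2 - ?r 2)"
        by (rule order_trans [rotated]) simp
      moreover have "0 < ?m\<^sup>2"
        by simp
      ultimately have "?r 2 \<le> (?r 1)\<^sup>2"
        by (simp only: zero_le_mult_iff) auto
      then show ?thesis
        using 0 insert.hyps by (simp add: numeral_2_eq_2)
    next
      case (Suc l)
      show ?thesis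
      \<comment> \<open>The middle mean has order \<open>k + 1\<close>, so this is the value given
        to the parameter of \<open>newton_step\<close>.\<close>
      proof (rule newton_step)
        show "?q l * ?q (Suc (Suc l)) \<le> (?q (Suc l))\<^sup>2"
          "?q (Suc l) * ?q (Suc (Suc (Suc l))) \<le> (?q (Suc (Suc l)))\<^sup>2"
          by (rule conc)+
        have "?q l * ?q (Suc (Suc (Suc l))) \<le> ?q (Suc l) * ?q (Suc (Suc l))"
        proof (rule log_concave_mult_le [where q = ?q])
          show "?q (Suc k) = 0" if "?q k = 0" for k
            using that insert.hyps insert.prems by (auto simp: esym_mean_eq_0_iff esym_Suc_eq_0)
        qed (auto intro: nonneg conc)
        then show "?q l * ?q (Suc (Suc (Suc l))) \<le> ?q (Suc l) * ?q (Suc (Suc l))" .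
        show "2 \<le> real (k + 1)" "real (k + 1) \<le> ?m - 1" "0 \<le> x a"
          using Suc le insert.prems by auto
        show "?m * ?r k = (?m - (real (k + 1) - 1)) * ?q (Suc l) + (real (k + 1) - 1) * x a * ?q l"
          "?m * ?r (Suc k) = (?m - real (k + 1)) * ?q (Suc (Suc l)) + real (k + 1) * x a * ?q (Suc l)"
          "?m * ?r (Suc (Suc k)) = (?m - (real (k + 1) + 1)) * ?q (Suc (Suc (Suc l)))
            + (real (k + 1) + 1) * x a * ?q (Suc (Suc l))"
          using r [of l] r [of k] r [of "Suc k"] by (simp_all add: Suc algebra_simps)
      qed
    qed
  qed
qed

corollary esym_mean_mult_le:
  assumes "finite A" "\<And>i. i \<in> A \<Longrightarrow> 0 \<le> x i" "i \<le> j"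
  shows "esym_mean A i x * esym_mean A (Suc j) x \<le> esym_mean A (Suc i) x * esym_mean A j x"
  using assms
  by (intro log_concave_mult_le [where q = "\<lambda>k. esym_mean A k x"])
     (auto intro: esym_mean_nonneg esym_mean_newton simp: esym_mean_eq_0_iff esym_Suc_eq_0)

section \<open>Extremal configurations\<close>

text \<open>With \<open>a\<close> regarded as the variable added last, \<open>newton_step_0\<close>
  bounds the squared distance of \<open>x a\<close> from the mean of the others by 0.\<close>

lemma esym_mean_newton_eq_imp_const:
  assumes "finite A" "2 \<le> card A" "\<And>i. i \<in> A \<Longrightarrow> 0 \<le> x i" "a \<in> A"
    and eq: "(esym_mean A 1 x)\<^sup>2 = esym_mean A 2 x"
  shows "x a = esym_mean A 1 x"
proof -
  define B where "B = A - {a}"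
  have B: "finite B" "a \<notin> B" and A: "A = insert a B"
    using assms by (auto simp: B_def)
  let ?m = "real (card B + 1)"
  have r: "?m * esym_mean A (Suc k) x =
      (?m - real (Suc k)) * esym_mean B (Suc k) x + real (Suc k) * x a * esym_mean B k x" for k
    using esym_mean_insert [OF B] by (simp add: A)
  have r1: "?m * esym_mean A 1 x = (?m - 1) * esym_mean B 1 x + x a"
    using r [of 0] B by simp
  have "(esym_mean B 1 x - x a)\<^sup>2 \<le> ?m\<^sup>2 * ((esym_mean A 1 x)\<^sup>2 - esym_mean A 2 x)"
  proof (rule newton_step_0 [OF _ _ r1])
    show "2 \<le> ?m"
      using assms(2) B by (simp add: A)
    show "esym_mean B 2 x \<le> (esym_mean B 1 x)\<^sup>2"
      using esym_mean_newton [of B x 0] B assms(3) by (simp add: A numeral_2_eq_2)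
    show "?m * esym_mean A 2 x = (?m - 2) * esym_mean B 2 x + 2 * x a * esym_mean B 1 x"
      using r [of 1] by (simp add: numeral_2_eq_2)
  qed
  then have "esym_mean B 1 x = x a"
    using eq by simp
  then have "?m * esym_mean A 1 x = ?m * x a"
    using r1 by (simp add: algebra_simps)
  then show ?thesis
    by simp
qed

lemma esym_mean_const:
  assumes "finite A" "k \<le> card A" "\<And>i. i \<in> A \<Longrightarrow> x i = c"
  shows "esym_mean A k x = c ^ k"
proof -
  have "esym A k x = (\<Sum>S | S \<subseteq> A \<and> card S = k. c ^ k)"
    unfolding esym_def
  proof (rule sum.cong)
    fix S assume S: "S \<in> {S. S \<subseteq> A \<and> card S = k}"
    then have "(\<Prod>i\<in>S. x i) = (\<Prod>i\<in>S. c)"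
      using assms(3) by (intro prod.cong) auto
    then show "(\<Prod>i\<in>S. x i) = c ^ k"
      using S by simp
  qed simp
  then show ?thesis
    using assms by (simp add: esym_mean_def n_subsets)
qed

lemma esym_eq_0_if_supported_on_singleton:
  assumes "finite A" "2 \<le> k" "\<And>j. j \<in> A \<Longrightarrow> j \<noteq> i \<Longrightarrow> x j = 0"
  shows "esym A k x = 0"
  unfolding esym_def
proof (intro sum.neutral ballI)
  fix S assume S: "S \<in> {S. S \<subseteq> A \<and> card S = k}"
  have "\<not> S \<subseteq> {i}"
    using S assms(2) card_mono [of "{i}" S] by auto
  then obtain j where "j \<in> S" "j \<noteq> i"
    by blast
  moreover have "finite S"
    using S assms(1) finite_subset by blast
  ultimately show "(\<Prod>i\<in>S. x i) = 0"
    using S assms(3) by (intro prod_zero) auto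
qed

lemma esym_2_eq_0D:
  assumes "finite A" "\<And>i. i \<in> A \<Longrightarrow> 0 \<le> x i" "esym A 2 x = 0" "i \<in> A" "j \<in> A" "i \<noteq> j"
  shows "x i = 0 \<or> x j = 0"
proof -
  have "\<forall>S\<in>{S. S \<subseteq> A \<and> card S = 2}. (\<Prod>i\<in>S. x i) = 0"
    using assms(1-3) unfolding esym_def
    by (subst (asm) sum_nonneg_eq_0_iff) (auto intro!: prod_nonneg)
  then have "(\<Prod>i\<in>{i, j}. x i) = 0"
    using assms(4-6) by (auto simp del: prod.insert)
  then show ?thesis
    using assms(6) by simp
qed

section \<open>Translation of all variables by 1\<close>

text \<open>Behind this is a count: with \<open>m = card A\<close>, each \<open>j\<close>-subset
  lies in \<open>(m - j) choose (k - j)\<close> of the \<open>k\<close>-subsets, and normalising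
  turns this into \<open>k choose j\<close>. The proof is instead an induction on \<open>A\<close>
  through \<open>esym_mean_insert\<close>.\<close>

lemma esym_mean_shift:
  assumes "finite A" "k \<le> card A"
  shows "esym_mean A k (\<lambda>i. 1 + x i) = (\<Sum>j\<le>k. real (k choose j) * esym_mean A j x)"
  using assms
proof (induction A arbitrary: k rule: finite_induct)
  case empty
  then show ?case by simp
next
  case (insert a A)
  let ?q = "\<lambda>j. esym_mean A j x" and ?m = "real (card A + 1)"
  let ?p = "\<lambda>k. esym_mean A k (\<lambda>i. 1 + x i)"
  show ?case
  proof (cases k)
    case 0
    then show ?thesis using insert.hyps by simp
  next
    case (Suc l)
    have l: "l \<le> card A"
      using insert.prems insert.hyps Suc by simp
    have r: "?m * esym_mean (insert a A) (Suc j) x =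
        (?m - real (Suc j)) * ?q (Suc j) + real (Suc j) * x a * ?q j" for j
      using esym_mean_insert [OF insert.hyps] by simp
    \<comment> \<open>For \<open>l = card A\<close> the induction hypothesis does not reach
      \<open>Suc l\<close>, but then the factor \<open>card A - l\<close> is 0.\<close>
    have p: "(real (card A) - real l) * ?p (Suc l) =
        (real (card A) - real l) * (\<Sum>j\<le>Suc l. real (Suc l choose j) * ?q j)"
      using insert.IH [of "Suc l"] l by (cases "l = card A") (simp_all del: sum.atMost_Suc)
    have absorb: "real (Suc l) * real (l choose j) = (real (Suc l) - real j) * real (Suc l choose j)"
      if "j \<le> Suc l" for j
    proof -
      have "(Suc l - j) * (Suc l choose j) = Suc l * (l choose j)"
        using binomial_absorb_comp [of "Suc l" j] by simp
      then show ?thesis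
        by (metis of_nat_diff of_nat_mult that)
    qed
    have "?m * (\<Sum>j\<le>Suc l. real (Suc l choose j) * esym_mean (insert a A) j x) =
        (\<Sum>j\<le>Suc l. real (Suc l choose j) * (?m * esym_mean (insert a A) j x))"
      by (simp add: sum_distrib_left mult_ac del: sum.atMost_Suc)
    also have "\<dots> = ?m + (\<Sum>j\<le>l. real (Suc l choose Suc j) *
        ((?m - real (Suc j)) * ?q (Suc j) + real (Suc j) * x a * ?q j))"
      by (simp only: sum.atMost_Suc_shift r) (simp add: insert.hyps del: binomial_Suc_Suc)
    also have "\<dots> = (\<Sum>j\<le>Suc l. real (Suc l choose j) * (?m - real j) * ?q j) +
        (\<Sum>j\<le>l. real (Suc j) * real (Suc l choose Suc j) * x a * ?q j)"
      using insert.hyps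
      by (simp add: sum.atMost_Suc_shift sum.distrib distrib_left distrib_right mult_ac
          del: sum.atMost_Suc binomial_Suc_Suc)
    \<comment> \<open>Since \<open>?m = card A + 1\<close>, the weight \<open>?m - j\<close> splits
      into \<open>card A - l\<close> and \<open>Suc l - j\<close>; the second part is absorbed into
      the binomial.\<close>
    also have "(\<Sum>j\<le>Suc l. real (Suc l choose j) * (?m - real j) * ?q j) =
        (\<Sum>j\<le>Suc l. (real (card A) - real l) * (real (Suc l choose j) * ?q j)
          + real (Suc l) * (real (l choose j) * ?q j))"
    proof (rule sum.cong)
      fix j assume "j \<in> {..Suc l}"
      then have "real (Suc l) * (real (l choose j) * ?q j) =
          (real (Suc l) - real j) * real (Suc l choose j) * ?q j"
        by (simp only: mult.assoc [symmetric] absorb atMost_iff)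
      then show "real (Suc l choose j) * (?m - real j) * ?q j =
          (real (card A) - real l) * (real (Suc l choose j) * ?q j)
          + real (Suc l) * (real (l choose j) * ?q j)"
        by (simp add: algebra_simps del: binomial_Suc_Suc)
    qed simp
    also have "\<dots> = (real (card A) - real l) * ?p (Suc l) + real (Suc l) * ?p l"
      unfolding sum.distrib sum_distrib_left [symmetric] p using insert.IH [OF l] by simp
    also have "(\<Sum>j\<le>l. real (Suc j) * real (Suc l choose Suc j) * x a * ?q j) =
        real (Suc l) * x a * ?p l"
    proof -
      have "real (Suc j) * real (Suc l choose Suc j) = real (Suc l) * real (l choose j)" for j
        by (metis Suc_times_binomial_eq mult.commute of_nat_mult)
      then show ?thesis
        using insert.IH [OF l] by (simp add: sum_distrib_left mult_ac del: binomial_Suc_Suc of_nat_Suc)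
    qed
    also have "(real (card A) - real l) * ?p (Suc l) + real (Suc l) * ?p l + real (Suc l) * x a * ?p l
        = ?m * esym_mean (insert a A) (Suc l) (\<lambda>i. 1 + x i)"
      unfolding esym_mean_insert [OF insert.hyps] by (simp add: algebra_simps)
    finally have "?m * esym_mean (insert a A) (Suc l) (\<lambda>i. 1 + x i) =
        ?m * (\<Sum>j\<le>Suc l. real (Suc l choose j) * esym_mean (insert a A) j x)"
      by (rule sym)
    moreover have "?m \<noteq> 0"
      by simp
    ultimately show ?thesis
      unfolding Suc by (metis mult_left_cancel)
  qed
qed

section \<open>Algebraic identities for the quotient expression\<close>

text \<open>With \<open>q k\<close> of degree \<open>k\<close>, the terms are grouped by degree from
  3 to 8; lower degrees cancel. Each bracket is a Newton difference, except
  \<open>(q 2)^2 - q 4\<close>, which is the sum of \<open>(q 2)^2 - q 1 * q 3\<close> and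
  \<open>q 1 * q 3 - q 4\<close>.\<close>

lemma esym_mean_shift_difference:
  fixes q :: "nat \<Rightarrow> real"
  defines "p \<equiv> \<lambda>k. \<Sum>j\<le>k. real (k choose j) * q j"
  assumes "q 0 = 1"
  shows "p 4 * (p 4 - 2 * p 2 + 1) - p 3 * (p 5 - 2 * p 3 + p 1) =
      4 * (q 1 * q 2 - q 3) + (8 * ((q 2)\<^sup>2 - q 1 * q 3) + 4 * ((q 2)\<^sup>2 - q 4))
      + (12 * (q 2 * q 3 - q 1 * q 4) + (q 1 * q 4 - q 5))
      + (8 * ((q 3)\<^sup>2 - q 2 * q 4) + 3 * (q 2 * q 4 - q 1 * q 5))
      + 3 * (q 3 * q 4 - q 2 * q 5) + ((q 4)\<^sup>2 - q 3 * q 5)"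
proof -
  have "p 1 = 1 + q 1" "p 2 = 1 + 2 * q 1 + q 2" "p 3 = 1 + 3 * q 1 + 3 * q 2 + q 3"
    "p 4 = 1 + 4 * q 1 + 6 * q 2 + 4 * q 3 + q 4"
    "p 5 = 1 + 5 * q 1 + 10 * q 2 + 10 * q 3 + 5 * q 4 + q 5"
    using assms(2) by (simp_all add: p_def eval_nat_numeral)
  then show ?thesis
    by (simp add: power2_eq_square algebra_simps)
qed

text \<open>The letters \<open>a\<close>, \<open>b\<close>, \<open>c\<close>, \<open>d\<close>, \<open>e\<close> stand for \<open>N - 1\<close>, ..., \<open>N - 5\<close>.\<close>

lemma esym_mean_quotient_form:
  fixes a b c d e \<sigma>1 \<sigma>2 \<sigma>3 \<sigma>4 \<sigma>5 p1 p2 p3 p4 p5 :: real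
  assumes "0 < a" "0 < b" "0 < c" "0 < d" "0 < p4"
    and s: "\<sigma>1 = a * p1" "\<sigma>2 = a * b / 2 * p2"
      "\<sigma>3 = a * b * c / 6 * p3"
      "\<sigma>4 = a * b * c * d / 24 * p4"
      "\<sigma>5 = a * b * c * d * e / 120 * p5"
  shows "(5 * (\<sigma>5 * \<sigma>3 / \<sigma>4) - 4 * e / d * \<sigma>4)
      + d * e / 6 * (4 * c / d * \<sigma>2 - 3 * (\<sigma>3\<^sup>2 / \<sigma>4))
      + b * c * d * e / 24 * (\<sigma>1 * \<sigma>3 / \<sigma>4 - 4 * a / d)
    = - (a * b * c * e / 6 / p4
        * (p4 * (p4 - 2 * p2 + 1) - p3 * (p5 - 2 * p3 + p1)))" (is "?Q = _")
proof -
  have nz: "a \<noteq> 0" "b \<noteq> 0" "c \<noteq> 0" "d \<noteq> 0" "p4 \<noteq> 0"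
    using assms(1-5) by auto
  have "5 * (\<sigma>5 * \<sigma>3 / \<sigma>4) = a * b * c * e / 6 * (p5 * p3 / p4)"
    "4 * e / d * \<sigma>4 = a * b * c * e / 6 * p4"
    "4 * c / d * \<sigma>2 = 2 * a * b * c / d * p2"
    "3 * (\<sigma>3\<^sup>2 / \<sigma>4) = 2 * a * b * c / d * (p3\<^sup>2 / p4)"
    "\<sigma>1 * \<sigma>3 / \<sigma>4 = 4 * a / d * (p1 * p3 / p4)"
    using nz unfolding s by (simp_all add: field_simps power2_eq_square)
  note eqs = this
  have "d * e / 6 * (2 * a * b * c / d * p2 - 2 * a * b * c / d * (p3\<^sup>2 / p4))
      = a * b * c * e / 6 * (2 * (p2 - p3\<^sup>2 / p4))"
    "b * c * d * e / 24 * (4 * a / d * (p1 * p3 / p4) - 4 * a / d) = a * b * c * e / 6 * (p1 * p3 / p4 - 1)"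
    using nz by (simp_all add: right_diff_distrib)
  \<comment> \<open>The outer weights are exactly those that give the three groups the common factor
    \<open>a * b * c * e / 6\<close>.\<close>
  then have "?Q = a * b * c * e / 6 * ((p5 * p3 / p4 - p4) + 2 * (p2 - p3\<^sup>2 / p4) + (p1 * p3 / p4 - 1))"
    unfolding eqs by (simp only: distrib_left right_diff_distrib)
  also have "(p5 * p3 / p4 - p4) + 2 * (p2 - p3\<^sup>2 / p4) + (p1 * p3 / p4 - 1)
      = - ((p4 * (p4 - 2 * p2 + 1) - p3 * (p5 - 2 * p3 + p1)) / p4)"
    using nz(5) by (simp add: field_simps power2_eq_square)
  finally show ?thesis
    by simp
qed

lemma choose_numeral_real:
  "real (m choose 1) = real m" "real (m choose 2) = real m * (real m - 1) / 2"
    "real (m choose 3) = real m * (real m - 1) * (real m - 2) / 6"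
    "real (m choose 4) = real m * (real m - 1) * (real m - 2) * (real m - 3) / 24"
    "real (m choose 5) = real m * (real m - 1) * (real m - 2) * (real m - 3) * (real m - 4) / 120"
  unfolding binomial_gbinomial gbinomial_prod_rev
  by (simp_all add: eval_nat_numeral)

section \<open>The inequality and its equality cases\<close>

theorem proposition3p3:
  fixes n :: nat and \<kappa> :: "nat \<Rightarrow> real"
  assumes "n > 5"
    and "\<forall>i\<in>{1..n-1}. \<kappa> i \<ge> 1"
  shows
    "let \<sigma> = (\<lambda>k. esym {1..n-1} k \<kappa>);
         N = real n;
         Q = (5 * (\<sigma> 5 * \<sigma> 3 / \<sigma> 4) - 4 * (N - 5) / (N - 4) * \<sigma> 4)
           + (N - 4) * (N - 5) / 6
             * (4 * (N - 3) / (N - 4) * \<sigma> 2 - 3 * ((\<sigma> 3)^2 / \<sigma> 4))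
           + (N - 2) * (N - 3) * (N - 4) * (N - 5) / 24
             * (\<sigma> 1 * \<sigma> 3 / \<sigma> 4 - 4 * (N - 1) / (N - 4))
     in Q \<le> 0 \<and>
        (Q = 0 \<longleftrightarrow>
           (\<forall>i\<in>{1..n-1}. \<forall>j\<in>{1..n-1}. \<kappa> i = \<kappa> j) \<or>
           (\<exists>i\<in>{1..n-1}. \<kappa> i > 1 \<and> (\<forall>j\<in>{1..n-1}. j \<noteq> i \<longrightarrow> \<kappa> j = 1)))"
proof -
  define A where "A = {1..n-1}"
  define x where "x = (\<lambda>i. \<kappa> i - 1)"
  define \<sigma> where "\<sigma> = (\<lambda>k. esym A k \<kappa>)"
  define p where "p = (\<lambda>k. esym_mean A k \<kappa>)"
  define q where "q = (\<lambda>k. esym_mean A k x)"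
  define N where "N = real n"
  define Q where "Q = (5 * (\<sigma> 5 * \<sigma> 3 / \<sigma> 4) - 4 * (N - 5) / (N - 4) * \<sigma> 4)
           + (N - 4) * (N - 5) / 6
             * (4 * (N - 3) / (N - 4) * \<sigma> 2 - 3 * ((\<sigma> 3)^2 / \<sigma> 4))
           + (N - 2) * (N - 3) * (N - 4) * (N - 5) / 24
             * (\<sigma> 1 * \<sigma> 3 / \<sigma> 4 - 4 * (N - 1) / (N - 4))"
  define D where "D = p 4 * (p 4 - 2 * p 2 + 1) - p 3 * (p 5 - 2 * p 3 + p 1)"
  have A: "finite A" "card A = n - 1" "5 \<le> card A"
    using assms(1) by (auto simp: A_def)
  have x: "0 \<le> x i" if "i \<in> A" for i
    using that assms(2) by (simp add: x_def A_def)
  have q0: "q 0 = 1" and q_nonneg: "0 \<le> q k" for k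
    using A x by (auto simp: q_def intro: esym_mean_nonneg)
  have p: "p k = (\<Sum>j\<le>k. real (k choose j) * q j)" if "k \<le> 5" for k
    using esym_mean_shift [of A k x] A that by (simp add: p_def q_def x_def)
  have p4: "0 < p 4"
  proof -
    have "0 < (\<Sum>j\<le>4. real (4 choose j) * q j)"
      \<comment> \<open>The term for \<open>j = 0\<close> equals 1 and all others are
        nonnegative.\<close>
      by (rule sum_pos2 [of _ 0]) (simp_all add: q0 q_nonneg)
    then show ?thesis
      using p by simp
  qed
  have N: "real (card A) = N - 1"
    using A assms(1) by (simp add: N_def)
  have "Q = - ((N - 1) * (N - 2) * (N - 3) * (N - 5) / 6 / p 4 * D)"
    unfolding Q_def D_def
  proof (rule esym_mean_quotient_form)
    show "\<sigma> 1 = (N - 1) * p 1" "\<sigma> 2 = (N - 1) * (N - 2) / 2 * p 2"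
      "\<sigma> 3 = (N - 1) * (N - 2) * (N - 3) / 6 * p 3"
      "\<sigma> 4 = (N - 1) * (N - 2) * (N - 3) * (N - 4) / 24 * p 4"
      "\<sigma> 5 = (N - 1) * (N - 2) * (N - 3) * (N - 4) * (N - 5) / 120 * p 5"
      unfolding \<sigma>_def p_def esym_eq_mean [OF A(1)] choose_numeral_real N
      by simp_all
  qed (use assms(1) p4 in \<open>simp_all add: N_def\<close>)
  \<comment> \<open>Strictness of \<open>n > 5\<close> makes \<open>N - 5\<close> positive, so
    \<open>Q\<close> and \<open>D\<close> vanish together.\<close>
  moreover have "0 < (N - 1) * (N - 2) * (N - 3) * (N - 5) / 6 / p 4"
    using assms(1) p4 by (simp add: N_def)
  ultimately obtain c where "Q = - (c * D)" "0 < c"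
    by blast
  then have Q_iff: "Q \<le> 0 \<longleftrightarrow> 0 \<le> D" "Q = 0 \<longleftrightarrow> D = 0"
    by (auto simp: zero_le_mult_iff)
  have D: "D = 4 * (q 1 * q 2 - q 3) + (8 * ((q 2)\<^sup>2 - q 1 * q 3) + 4 * ((q 2)\<^sup>2 - q 4))
      + (12 * (q 2 * q 3 - q 1 * q 4) + (q 1 * q 4 - q 5))
      + (8 * ((q 3)\<^sup>2 - q 2 * q 4) + 3 * (q 2 * q 4 - q 1 * q 5))
      + 3 * (q 3 * q 4 - q 2 * q 5) + ((q 4)\<^sup>2 - q 3 * q 5)"
    using esym_mean_shift_difference [of q, OF q0] by (simp add: D_def p)
  have newton: "q i * q (Suc j) \<le> q (Suc i) * q j" if "i \<le> j" for i j
    unfolding q_def using A(1) x that by (rule esym_mean_mult_le)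
  have 1: "q 3 \<le> q 1 * q 2" and "q 1 * q 3 \<le> (q 2)\<^sup>2" "q 4 \<le> q 1 * q 3"
    "q 1 * q 4 \<le> q 2 * q 3" "q 5 \<le> q 1 * q 4" "q 2 * q 4 \<le> (q 3)\<^sup>2" "q 1 * q 5 \<le> q 2 * q 4"
    "q 2 * q 5 \<le> q 3 * q 4" "q 3 * q 5 \<le> (q 4)\<^sup>2"
    using newton [of 0 2] newton [of 1 2] newton [of 0 3] newton [of 1 3] newton [of 0 4]
      newton [of 2 3] newton [of 1 4] newton [of 2 4] newton [of 3 4]
    by (simp_all add: eval_nat_numeral q0)
  note ineqs = this
  \<comment> \<open>Only the bracket of degree 3 is kept: its vanishing alone determines the
    equality cases.\<close>
  have D_ge: "4 * (q 1 * q 2 - q 3) \<le> D"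
    unfolding D using ineqs
    by (intro add_increasing2 add_nonneg_nonneg mult_nonneg_nonneg) simp_all
  have "D = 0 \<longleftrightarrow> (\<forall>i\<in>A. \<forall>j\<in>A. \<kappa> i = \<kappa> j) \<or>
      (\<exists>i\<in>A. \<kappa> i > 1 \<and> (\<forall>j\<in>A. j \<noteq> i \<longrightarrow> \<kappa> j = 1))" (is "_ \<longleftrightarrow> ?const \<or> ?single")
  proof
    assume "D = 0"
    then have q3: "q 3 = q 1 * q 2"
      using D_ge by (intro antisym 1) simp
    show "?const \<or> ?single"
    proof (cases "q 2 = 0")
      case True
      have e2: "esym A 2 x = 0"
        using True A by (simp add: q_def esym_mean_eq_0_iff)
      have two: "x i = 0 \<or> x j = 0" if "i \<in> A" "j \<in> A" "i \<noteq> j" for i j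
        using A(1) x e2 that by (rule esym_2_eq_0D)
      show ?thesis
      proof (cases "\<forall>i\<in>A. x i = 0")
        case True
        then show ?thesis by (simp add: x_def)
      next
        case False
        then obtain i where i: "i \<in> A" "x i \<noteq> 0"
          by blast
        then have "1 < \<kappa> i"
          using x [OF i(1)] by (simp add: x_def)
        moreover have "\<kappa> j = 1" if "j \<in> A" "j \<noteq> i" for j
          using two [OF i(1) that(1)] i(2) that(2) by (simp add: x_def)
        ultimately show ?thesis
          using i(1) by blast
      qed
    next
      case False
      then have "0 < q 2"
        using q_nonneg [of 2] by linarith
      \<comment> \<open>Substituting \<open>q 3 = q 1 * q 2\<close> into
        \<open>q 1 * q 3 \<le> (q 2)^2\<close> reverses Newton's inequality
        \<open>q 2 \<le> (q 1)^2\<close> once \<open>q 2 > 0\<close> is cancelled.\<close>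
      moreover have "q 2 * (q 1)\<^sup>2 \<le> q 2 * q 2"
        using \<open>q 1 * q 3 \<le> (q 2)\<^sup>2\<close> by (simp add: q3 power2_eq_square mult_ac)
      ultimately have "(q 1)\<^sup>2 \<le> q 2"
        by simp
      moreover have "q 2 \<le> (q 1)\<^sup>2"
        using newton [of 0 1] by (simp add: q0 numeral_2_eq_2)
      ultimately have "(q 1)\<^sup>2 = q 2"
        by simp
      then have "x i = q 1" if "i \<in> A" for i
        using esym_mean_newton_eq_imp_const [of A x i] A x that by (simp add: q_def)
      then have "\<kappa> i = q 1 + 1" if "i \<in> A" for i
        using that by (simp add: x_def algebra_simps)
      then show ?thesis by simp
    qed
  next
    assume "?const \<or> ?single"
    then show "D = 0"
    proof
      assume ?const
      have "1 \<in> A"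
        using assms(1) by (simp add: A_def)
      then have "\<kappa> i = \<kappa> 1" if "i \<in> A" for i
        using \<open>?const\<close> that by blast
      then have "x i = x 1" if "i \<in> A" for i
        using that unfolding x_def by (metis (no_types))
      \<comment> \<open>The two products in each bracket of \<open>D\<close> have the same degree,
        so for pure powers they cancel.\<close>
      then have "q k = x 1 ^ k" if "k \<le> 5" for k
        unfolding q_def using A that by (intro esym_mean_const) auto
      then show ?thesis
        by (simp add: D eval_nat_numeral)
    next
      assume ?single
      then obtain i where "\<And>j. j \<in> A \<Longrightarrow> j \<noteq> i \<Longrightarrow> x j = 0"
        by (auto simp: x_def)
      \<comment> \<open>Every monomial of \<open>D\<close> contains some \<open>q k\<close> with
        \<open>k\<close> at least 2.\<close>
      then have "q k = 0" if "2 \<le> k" for k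
        using that A esym_eq_0_if_supported_on_singleton [of A k i x]
        by (simp add: q_def esym_mean_eq_0_iff)
      then show ?thesis
        by (simp add: D)
    qed
  qed
  moreover have "0 \<le> D"
    by (rule order_trans [OF _ D_ge]) (use 1 in simp)
  ultimately have "Q \<le> 0 \<and> (Q = 0 \<longleftrightarrow> (\<forall>i\<in>A. \<forall>j\<in>A. \<kappa> i = \<kappa> j) \<or>
      (\<exists>i\<in>A. \<kappa> i > 1 \<and> (\<forall>j\<in>A. j \<noteq> i \<longrightarrow> \<kappa> j = 1)))"
    using Q_iff by simp
  then show ?thesis
    unfolding Let_def Q_def \<sigma>_def N_def A_def .
qed

end
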